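(* Every countably infinite MB-homogeneous graph is HE-homogeneous.
   Context: All graphs are undirected and loopless; subgraphs are induced. A homomorphism maps adjacent vertices to adjacent vertices; a monomorphism is an injective homomorphism; a bimorphism of $G$ is a bijective endomorphism $G\to G$. $G$ is MB-homogeneous if every monomorphism between finite induced subgraphs of $G$ is the restriction of a bimorphism of $G$; $G$ is HE-homogeneous if every homomorphism between finite induced subgraphs of $G$ is the restriction of a surjective endomorphism of $G$. *)

theory Defs
  imports Main "HOL-Library.Countable_Set"
begin

definition graph :: "'a set \<Rightarrow> ('a \<Rightarrow> 'a \<Rightarrow> bool) \<Rightarrow> bool" where
  "graph V E \<longleftrightarrow> (\<forall>x y. E x y \<longrightarrow> x \<in> V \<and> y \<in> V) \<and>
                   (\<forall>x y. E x y \<longrightarrow> E y x) \<and> (\<forall>x. \<not> E x x)"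

definition hom_on :: "'a set \<Rightarrow> ('a \<Rightarrow> 'a \<Rightarrow> bool) \<Rightarrow> 'a set \<Rightarrow> ('a \<Rightarrow> 'a) \<Rightarrow> bool" where
  "hom_on V E A f \<longleftrightarrow> A \<subseteq> V \<and> f ` A \<subseteq> V \<and>
                       (\<forall>x\<in>A. \<forall>y\<in>A. E x y \<longrightarrow> E (f x) (f y))"

definition mono_on_graph :: "'a set \<Rightarrow> ('a \<Rightarrow> 'a \<Rightarrow> bool) \<Rightarrow> 'a set \<Rightarrow> ('a \<Rightarrow> 'a) \<Rightarrow> bool" where
  "mono_on_graph V E A f \<longleftrightarrow> hom_on V E A f \<and> inj_on f A"

definition bimorphism :: "'a set \<Rightarrow> ('a \<Rightarrow> 'a \<Rightarrow> bool) \<Rightarrow> ('a \<Rightarrow> 'a) \<Rightarrow> bool" where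
  "bimorphism V E g \<longleftrightarrow> hom_on V E V g \<and> bij_betw g V V"

definition surj_endomorphism :: "'a set \<Rightarrow> ('a \<Rightarrow> 'a \<Rightarrow> bool) \<Rightarrow> ('a \<Rightarrow> 'a) \<Rightarrow> bool" where
  "surj_endomorphism V E g \<longleftrightarrow> hom_on V E V g \<and> g ` V = V"

definition MB_homogeneous :: "'a set \<Rightarrow> ('a \<Rightarrow> 'a \<Rightarrow> bool) \<Rightarrow> bool" where
  "MB_homogeneous V E \<longleftrightarrow>
     (\<forall>A f. finite A \<and> mono_on_graph V E A f \<longrightarrow>
        (\<exists>g. bimorphism V E g \<and> (\<forall>x\<in>A. g x = f x)))"

definition HE_homogeneous :: "'a set \<Rightarrow> ('a \<Rightarrow> 'a \<Rightarrow> bool) \<Rightarrow> bool" where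
  "HE_homogeneous V E \<longleftrightarrow>
     (\<forall>A f. finite A \<and> hom_on V E A f \<longrightarrow>
        (\<exists>g. surj_endomorphism V E g \<and> (\<forall>x\<in>A. g x = f x)))"

end

theory Submission
  imports Defs
begin

text \<open>
  A partial homomorphism \<open>f\<close> with finite domain \<open>A\<close> can always be extended to one more vertex: restrict \<open>f\<close> to
  a transversal of its fibres, which gives a monomorphism, and use a bimorphism extending it. To put
  \<open>w\<close> into the range one needs a new vertex \<open>v\<close> whose neighbours in \<open>A\<close> are mapped into the neighbourhood
  of \<open>w\<close>. This is trivial if every finite set has a vertex outside it that is adjacent to none of its
  elements. Otherwise pass to the complement \<open>H\<close>, which is again MB-homogeneous and in which some finite set has
  no common neighbour; \<open>H\<close> contains arbitrarily large independent sets. Let \<open>m\<close> be least such that some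
  \<open>m\<close>-set has no common neighbour; then no independent \<open>m\<close>-set has one. If \<open>m \<le> 2\<close>, then \<open>H\<close> is a disjoint union of
  cliques, which are infinite if \<open>H\<close> has an edge, and the vertex \<open>v\<close> is found directly. The case
  \<open>m \<ge> 3\<close> is impossible: \<open>H\<close> would look locally like the line graph of a complete hypergraph, with
  the vertices adjacent to an independent \<open>(m-1)\<close>-set \<open>U\<close> in the role of the hyperedge \<open>U\<close>; there, three
  pairwise adjacent hyperedges with empty intersection behave differently from three hyperedges through a point.
\<close>

section \<open>Passing to the complement\<close>

lemma graph_complement:
  assumes "graph V E"
  shows "graph V (\<lambda>x y. x \<in> V \<and> y \<in> V \<and> x \<noteq> y \<and> \<not> E x y)"
  using assms unfolding graph_def by blast

text \<open>A monomorphism \<open>f\<close> of the complement has as inverse a monomorphism of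
  \<open>E\<close>: an edge between images forces an edge between preimages. If a bimorphism
  \<open>g\<close> of \<open>E\<close> extends that inverse, then the inverse of \<open>g\<close>
  preserves non-edges and extends \<open>f\<close>.\<close>

lemma MB_homogeneous_complement:
  assumes "graph V E" "MB_homogeneous V E"
  shows "MB_homogeneous V (\<lambda>x y. x \<in> V \<and> y \<in> V \<and> x \<noteq> y \<and> \<not> E x y)"
    (is "MB_homogeneous V ?H")
  unfolding MB_homogeneous_def
proof (intro allI impI, elim conjE)
  fix A f assume A: "finite A" and m: "mono_on_graph V ?H A f"
  have AV: "A \<subseteq> V" "f ` A \<subseteq> V" "inj_on f A"
    and hom: "\<And>x y. x \<in> A \<Longrightarrow> y \<in> A \<Longrightarrow> ?H x y \<Longrightarrow> ?H (f x) (f y)"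
    using m unfolding mono_on_graph_def hom_on_def by blast+
  have irr: "\<And>x. \<not> E x x" using assms(1) unfolding graph_def by blast
  let ?h = "inv_into A f"
  have "mono_on_graph V E (f ` A) ?h"
    unfolding mono_on_graph_def hom_on_def
  proof (intro conjI ballI impI)
    show "?h ` f ` A \<subseteq> V" using AV by auto
    show "inj_on ?h (f ` A)" by (rule inj_on_inv_into) simp
    fix x y assume xy: "x \<in> f ` A" "y \<in> f ` A" "E x y"
    then obtain a b where ab: "a \<in> A" "b \<in> A" "x = f a" "y = f b" by blast
    have "a \<noteq> b" using xy ab irr by auto
    then have "E a b" using hom[of a b] ab xy AV by auto
    then show "E (?h x) (?h y)" using ab AV by simp
  qed (use AV in auto)
  then obtain g where g: "bimorphism V E g" "\<forall>x\<in>f ` A. g x = ?h x"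
    using assms(2) A unfolding MB_homogeneous_def by blast
  have bij: "bij_betw g V V" and ghom: "\<And>x y. x \<in> V \<Longrightarrow> y \<in> V \<Longrightarrow> E x y \<Longrightarrow> E (g x) (g y)"
    using g(1) unfolding bimorphism_def hom_on_def by blast+
  let ?i = "inv_into V g"
  have ibij: "bij_betw ?i V V" using bij by (rule bij_betw_inv_into)
  have iV: "?i x \<in> V" "g (?i x) = x" if "x \<in> V" for x
    using that bij ibij by (auto simp: bij_betw_def f_inv_into_f)
  have "bimorphism V ?H ?i"
    unfolding bimorphism_def hom_on_def
  proof (intro conjI ballI impI)
    fix x y assume xy: "x \<in> V" "y \<in> V" "x \<in> V \<and> y \<in> V \<and> x \<noteq> y \<and> \<not> E x y"
    show "?i x \<noteq> ?i y" using xy iV by metis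
    show "\<not> E (?i x) (?i y)" using xy iV ghom by metis
  qed (use iV ibij in auto)
  moreover have "?i x = f x" if "x \<in> A" for x
  proof -
    have "g (f x) = x" using g(2) that AV by simp
    then show ?thesis using bij AV that by (metis bij_betw_inv_into_left image_subset_iff)
  qed
  ultimately show "\<exists>g. bimorphism V ?H g \<and> (\<forall>x\<in>A. g x = f x)" by blast
qed

section \<open>Back and forth from one-point extensions\<close>

text \<open>Stage \<open>n\<close> puts the \<open>n\<close>-th vertex of an enumeration of
  \<open>V\<close> into the domain and then into the range. The union of the stages is a total and
  surjective homomorphism.\<close>

lemma HE_homogeneous_back_and_forth:
  assumes "countable V" "infinite V"
    and ext_dom: "\<And>A f v. finite A \<Longrightarrow> hom_on V E A f \<Longrightarrow> v \<in> V \<Longrightarrow> v \<notin> A \<Longrightarrow>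
        \<exists>w\<in>V. hom_on V E (insert v A) (f(v := w))"
    and ext_ran: "\<And>A f w. finite A \<Longrightarrow> hom_on V E A f \<Longrightarrow> w \<in> V \<Longrightarrow> w \<notin> f ` A \<Longrightarrow>
        \<exists>v\<in>V. v \<notin> A \<and> hom_on V E (insert v A) (f(v := w))"
  shows "HE_homogeneous V E"
  unfolding HE_homogeneous_def
proof (intro allI impI, elim conjE)
  fix A0 f0 assume A0: "finite A0" "hom_on V E A0 f0"
  let ?e = "from_nat_into V"
  have ran: "range ?e = V" using assms(1,2) by (metis range_from_nat_into finite.emptyI)
  let ?P = "\<lambda>p. finite (fst p) \<and> hom_on V E (fst p) (snd p)"
  let ?le = "\<lambda>p q. fst p \<subseteq> fst q \<and> (\<forall>x\<in>fst p. snd q x = snd p x)"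
  let ?Q = "\<lambda>n p q. ?le p q \<and> ?e n \<in> fst q \<and> ?e n \<in> snd q ` fst q"
  have step: "\<exists>q. ?P q \<and> ?Q n p q" if p: "?P p" for p n
  proof -
    have en: "?e n \<in> V" using ran by blast
    obtain q where q: "?P q" "?le p q" "?e n \<in> fst q"
    proof (cases "?e n \<in> fst p")
      case True then show ?thesis using that[of p] p by blast
    next
      case False
      then obtain w where "hom_on V E (insert (?e n) (fst p)) ((snd p)(?e n := w))"
        using ext_dom p en by meson
      then show ?thesis
        using p False by (intro that[of "(insert (?e n) (fst p), (snd p)(?e n := w))"]) auto
    qed
    show ?thesis
    proof (cases "?e n \<in> snd q ` fst q")
      case True then show ?thesis using q by blast
    next
      case False
      then obtain v where "v \<notin> fst q" "hom_on V E (insert v (fst q)) ((snd q)(v := ?e n))"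
        using ext_ran q(1) en by meson
      then show ?thesis
        using q by (intro exI[of _ "(insert v (fst q), (snd q)(v := ?e n))"]) auto
    qed
  qed
  obtain s0 where s0: "?P s0" "s0 = (A0, f0)" using A0 by simp
  have "\<exists>s. s 0 = s0 \<and> (\<forall>n. ?P (s n) \<and> ?Q n (s n) (s (Suc n)))"
  proof -
    have "\<exists>s. \<forall>n. (?P (s n) \<and> (n = 0 \<longrightarrow> s n = s0)) \<and> ?Q n (s n) (s (Suc n))"
      by (rule dependent_nat_choice) (use s0 step in auto)
    then show ?thesis by blast
  qed
  then obtain s where s: "s 0 = s0" "\<And>n. ?P (s n)" "\<And>n. ?Q n (s n) (s (Suc n))" by blast
  have le: "?le (s m) (s n)" if "m \<le> n" for m n
    using that
  proof (induction n rule: dec_induct)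
    case (step n)
    then show ?case using s(3)[of n] by auto
  qed simp
  have ex: "\<exists>n. x \<in> fst (s n)" if "x \<in> V" for x
    using that ran s(3) by (metis imageE)
  \<comment> \<open>The value is read off at the first stage whose domain contains \<open>x\<close>;
    by \<open>le\<close> every later stage agrees with it.\<close>
  define g where "g x = snd (s (LEAST n. x \<in> fst (s n))) x" for x
  have g: "g x = snd (s n) x" if "x \<in> fst (s n)" for x n
    unfolding g_def using that le[of "LEAST n. x \<in> fst (s n)" n]
    by (metis (mono_tags, lifting) LeastI Least_le)
  have hom: "fst (s n) \<subseteq> V" "snd (s n) ` fst (s n) \<subseteq> V"
     "\<And>x y. x \<in> fst (s n) \<Longrightarrow> y \<in> fst (s n) \<Longrightarrow> E x y \<Longrightarrow> E (snd (s n) x) (snd (s n) y)" for n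
    using s(2)[of n] unfolding hom_on_def by blast+
  have "hom_on V E V g"
    unfolding hom_on_def
  proof (intro conjI ballI impI)
    show "g ` V \<subseteq> V" using ex g hom(2) by fastforce
    fix x y assume xy: "x \<in> V" "y \<in> V" "E x y"
    obtain m n where mn: "x \<in> fst (s m)" "y \<in> fst (s n)" using ex xy by meson
    have "x \<in> fst (s (max m n))" "y \<in> fst (s (max m n))"
      using mn le[of m "max m n"] le[of n "max m n"] by auto
    then show "E (g x) (g y)" using g hom(3) xy by simp
  qed simp
  moreover have "V \<subseteq> g ` V"
  proof
    fix y assume "y \<in> V"
    then obtain n where "y = ?e n" using ran by blast
    then obtain x where "x \<in> fst (s (Suc n))" "y = snd (s (Suc n)) x" using s(3)[of n] by blast
    then have "x \<in> V" "y = g x" using g hom(1) by auto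
    then show "y \<in> g ` V" by blast
  qed
  ultimately have "surj_endomorphism V E g"
    unfolding surj_endomorphism_def hom_on_def by blast
  moreover have "\<forall>x\<in>A0. g x = f0 x" using g[of _ 0] s(1) s0 by simp
  ultimately show "\<exists>g. surj_endomorphism V E g \<and> (\<forall>x\<in>A0. g x = f0 x)" by blast
qed

section \<open>Extending and transporting finite configurations\<close>

locale MB_graph =
  fixes V :: "'a set" and E :: "'a \<Rightarrow> 'a \<Rightarrow> bool"
  assumes graph: "graph V E" and MB: "MB_homogeneous V E" and infinite_V: "infinite V"
begin

text \<open>For nonempty \<open>S\<close> this forces \<open>c \<in> V\<close>; for empty
  \<open>S\<close> it holds for every \<open>c\<close>, even outside \<open>V\<close>, which is why
  empty sets are treated separately below.\<close>

definition adj_all :: "'a \<Rightarrow> 'a set \<Rightarrow> bool" where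
  "adj_all c S \<longleftrightarrow> (\<forall>s\<in>S. E c s)"

definition indep :: "'a set \<Rightarrow> bool" where
  "indep S \<longleftrightarrow> S \<subseteq> V \<and> finite S \<and> (\<forall>x\<in>S. \<forall>y\<in>S. \<not> E x y)"

lemma sym: "E x y \<Longrightarrow> E y x" and irrefl: "\<not> E x x" and in_V: "E x y \<Longrightarrow> x \<in> V" "E x y \<Longrightarrow> y \<in> V"
proof -
  have *: "\<forall>x y. E x y \<longrightarrow> x \<in> V \<and> y \<in> V" "\<forall>x y. E x y \<longrightarrow> E y x" "\<forall>x. \<not> E x x"
    using graph unfolding graph_def by blast+
  show "E x y \<Longrightarrow> E y x" "\<not> E x x" "E x y \<Longrightarrow> x \<in> V" "E x y \<Longrightarrow> y \<in> V"
    using * by simp_all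
qed

lemma adj_commute: "E x y \<longleftrightarrow> E y x"
  using sym by metis

lemma fresh_vertex:
  assumes "finite A"
  obtains v where "v \<in> V" "v \<notin> A"
proof -
  have "\<not> V \<subseteq> A" using assms infinite_V finite_subset by metis
  then show ?thesis using that by blast
qed

lemma indep_subset: "indep T \<Longrightarrow> S \<subseteq> T \<Longrightarrow> indep S"
  unfolding indep_def using finite_subset by blast

lemma indep_insert:
  assumes "indep I" "v \<in> V" "\<And>x. x \<in> I \<Longrightarrow> \<not> E v x"
  shows "indep (insert v I)"
  using assms irrefl adj_commute unfolding indep_def by simp

lemma bimorphism_extends:
  assumes "finite A" "A \<subseteq> V" "f ` A \<subseteq> V" "inj_on f A"
    and "\<And>x y. x \<in> A \<Longrightarrow> y \<in> A \<Longrightarrow> E x y \<Longrightarrow> E (f x) (f y)"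
  obtains g where "bij_betw g V V" "\<And>x y. E x y \<Longrightarrow> E (g x) (g y)" "\<And>x. x \<in> A \<Longrightarrow> g x = f x"
proof -
  have "mono_on_graph V E A f"
    using assms unfolding mono_on_graph_def hom_on_def by blast
  then obtain g where "bimorphism V E g" "\<forall>x\<in>A. g x = f x"
    using MB assms(1) unfolding MB_homogeneous_def by blast
  then have g: "bij_betw g V V" "\<forall>x\<in>V. \<forall>y\<in>V. E x y \<longrightarrow> E (g x) (g y)" "\<forall>x\<in>A. g x = f x"
    unfolding bimorphism_def hom_on_def by simp_all
  have "E (g x) (g y)" if "E x y" for x y
    using g(2) in_V[OF that] that by simp
  then show ?thesis using that[of g] g by simp
qed

lemma hom_on_extend:
  assumes "finite A" "hom_on V E A f" "v \<in> V" "v \<notin> A"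
  shows "\<exists>w\<in>V. hom_on V E (insert v A) (f(v := w))"
proof -
  have A: "A \<subseteq> V" "f ` A \<subseteq> V" "\<And>x y. x \<in> A \<Longrightarrow> y \<in> A \<Longrightarrow> E x y \<Longrightarrow> E (f x) (f y)"
    using assms(2) unfolding hom_on_def by blast+
  define N where "N = {a \<in> A. E v a}"
  \<comment> \<open>\<open>T\<close> contains one vertex from each fibre of \<open>f\<close> on the
    neighbours of \<open>v\<close>. So \<open>f\<close> is a monomorphism on \<open>T\<close>, and
    being adjacent to \<open>f\<close> T\<open>is the same as being adjacent to\<close>f
    \<open>N\<close>.\<close>
  obtain T where T: "T \<subseteq> N" "inj_on f T" "f ` T = f ` N"
    by (metis subset_image_inj subset_refl)
  have TA: "T \<subseteq> A" using T(1) N_def by auto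
  have TV: "finite T" "T \<subseteq> V" "f ` T \<subseteq> V"
    using TA A(1,2) assms(1) finite_subset by blast+
  have Thom: "E (f x) (f y)" if "x \<in> T" "y \<in> T" "E x y" for x y
    using A(3)[of x y] that TA by auto
  obtain g where g: "bij_betw g V V" "\<And>x y. E x y \<Longrightarrow> E (g x) (g y)" "\<And>x. x \<in> T \<Longrightarrow> g x = f x"
    by (rule bimorphism_extends[OF TV T(2)]) (use Thom in blast)+
  have "E (g v) (f x)" if xN: "x \<in> N" for x
  proof -
    have "f x \<in> f ` T" using T(3) xN by simp
    then obtain t where "t \<in> T" "f t = f x" by auto
    then show ?thesis using g(2)[of v t] g(3)[of t] T(1) N_def by auto
  qed
  moreover have "g v \<in> V" using g(1) assms(3) by (auto simp: bij_betw_def)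
  ultimately have "hom_on V E (insert v A) (f(v := g v))"
    using A assms(3,4) irrefl adj_commute[of _ v] adj_commute[of _ "g v"]
    unfolding hom_on_def N_def by auto
  then show ?thesis using \<open>g v \<in> V\<close> by blast
qed

text \<open>Since the vertices of \<open>R\<close> are isolated in \<open>P \<union> R\<close>,
  combining \<open>f\<close> with any bijection from \<open>R\<close> to \<open>R'\<close> gives a
  monomorphism; a bimorphism extending it carries \<open>c\<close> to the required vertex. The lemma
  reduces common neighbours of arbitrary sets to those of one well chosen configuration with few
  edges.\<close>

lemma common_neighbour_transfer:
  assumes "finite P" "finite R" "P \<subseteq> V" "R \<subseteq> V" "P \<inter> R = {}"
    and isolated: "\<And>r x. r \<in> R \<Longrightarrow> x \<in> P \<union> R \<Longrightarrow> \<not> E r x"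
    and f: "inj_on f P" "f ` P \<subseteq> V" "\<And>x y. x \<in> P \<Longrightarrow> y \<in> P \<Longrightarrow> E x y \<Longrightarrow> E (f x) (f y)"
    and R': "finite R'" "R' \<subseteq> V" "card R' = card R" "f ` P \<inter> R' = {}"
    and c: "adj_all c (P \<union> R)"
  shows "\<exists>c'\<in>V. adj_all c' (f ` P \<union> R')"
proof (cases "P \<union> R = {}")
  case True
  then have "R' = {}" using R' by auto
  then show ?thesis using True fresh_vertex[of "{}"] by (auto simp: adj_all_def)
next
  case False
  then have cV: "c \<in> V" using c in_V unfolding adj_all_def by blast
  obtain b where b: "bij_betw b R R'" using assms(2) R' finite_same_card_bij by metis
  define h where "h x = (if x \<in> P then f x else b x)" for x
  have h: "h ` P = f ` P" "h ` R = R'" "\<And>x. x \<in> P \<Longrightarrow> h x = f x" "\<And>x. x \<in> R \<Longrightarrow> h x = b x"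
    using b assms(5) unfolding h_def bij_betw_def by auto
  have "inj_on h P" "inj_on h R"
    using f(1) b h(3,4) unfolding bij_betw_def inj_on_def by metis+
  moreover have "h ` P \<inter> h ` R = {}" using h R'(4) by simp
  ultimately have "inj_on h (P \<union> R)" unfolding inj_on_Un by blast
  moreover have "h ` (P \<union> R) \<subseteq> V" using h R' f by (simp add: image_Un)
  moreover have "E (h x) (h y)" if "x \<in> P \<union> R" "y \<in> P \<union> R" "E x y" for x y
    using that isolated sym f(3) h by (metis Un_iff)
  ultimately obtain g where g: "bij_betw g V V" "\<And>x y. E x y \<Longrightarrow> E (g x) (g y)"
      "\<And>x. x \<in> P \<union> R \<Longrightarrow> g x = h x"
    using bimorphism_extends[of "P \<union> R" h] assms(1-4) by (metis finite_Un sup.bounded_iff)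
  have "E (g c) (h x)" if "x \<in> P \<union> R" for x
    using g(2)[of c x] g(3)[OF that] c that unfolding adj_all_def by auto
  then have "adj_all (g c) (h ` P \<union> h ` R)" unfolding adj_all_def by blast
  then show ?thesis using h g(1) cV unfolding bij_betw_def by (metis imageI)
qed

text \<open>Any bijection from the independent set \<open>I\<close> to \<open>S\<close> is a
  monomorphism. In a bimorphism extending it, the preimage of \<open>v\<close> has no neighbour in
  \<open>I\<close>, because an edge would be mapped to an edge from \<open>v\<close> to
  \<open>S\<close>.\<close>

lemma co_neighbour_pullback:
  assumes I: "indep I" and S: "finite S" "S \<subseteq> V" "card S = card I"
    and v: "v \<in> V" "v \<notin> S" "\<And>s. s \<in> S \<Longrightarrow> \<not> E v s"
  obtains u where "u \<notin> I" "indep (insert u I)"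
proof -
  have IV: "finite I" "I \<subseteq> V" "\<And>x y. x \<in> I \<Longrightarrow> y \<in> I \<Longrightarrow> \<not> E x y"
    using I unfolding indep_def by blast+
  obtain b where b: "bij_betw b I S" using IV S finite_same_card_bij by metis
  have b': "b ` I = S" "inj_on b I" using b unfolding bij_betw_def by auto
  obtain g where g: "bij_betw g V V" "\<And>x y. E x y \<Longrightarrow> E (g x) (g y)" "\<And>x. x \<in> I \<Longrightarrow> g x = b x"
    using bimorphism_extends[of I b] IV b' S by metis
  obtain u where u: "u \<in> V" "g u = v" using g(1) v(1) unfolding bij_betw_def by (metis imageE)
  have "b x \<in> S" if "x \<in> I" for x using b' that by auto
  then have "u \<notin> I" "\<And>x. x \<in> I \<Longrightarrow> \<not> E u x" using u g(2,3) v by metis+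
  then have "indep (insert u I)"
    using indep_insert I u(1) by blast
  then show ?thesis using that \<open>u \<notin> I\<close> by blast
qed

end

section \<open>Arbitrarily large independent sets\<close>

locale MB_graph_no_ext = MB_graph +
  assumes no_ext: "\<exists>F. finite F \<and> F \<subseteq> V \<and> (\<forall>c. \<not> adj_all c F)"
begin

text \<open>If all vertices had only finitely many non-neighbours, every finite set would have a common
  neighbour. An infinite set of non-neighbours contains images of all finite independent sets.\<close>

lemma indep_extend1:
  assumes I: "indep I"
  obtains u where "u \<notin> I" "indep (insert u I)"
proof -
  obtain F where F: "finite F" "F \<subseteq> V" "\<And>c. \<not> adj_all c F" using no_ext by blast
  have "\<exists>v\<in>F. infinite {x\<in>V. \<not> E v x}"
  proof (rule ccontr)
    assume "\<not> ?thesis"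
    then have "finite (\<Union>v\<in>F. {x\<in>V. \<not> E v x})" using F by blast
    then obtain c where "c \<in> V" "c \<notin> (\<Union>v\<in>F. {x\<in>V. \<not> E v x})"
      by (rule fresh_vertex)
    then have "adj_all c F" using sym unfolding adj_all_def by blast
    then show False using F by blast
  qed
  then obtain v where v: "v \<in> F" "infinite {x\<in>V. \<not> E v x}" by blast
  then have "infinite ({x\<in>V. \<not> E v x} - {v})" by simp
  then obtain S where "S \<subseteq> {x\<in>V. \<not> E v x} - {v}" "card S = card I" "finite S"
    using infinite_arbitrarily_large[of _ "card I"] by blast
  then show ?thesis using co_neighbour_pullback[OF I, of S v] v F that by blast
qed

lemma indep_extend:
  assumes "indep I"
  obtains J where "finite J" "card J = n" "I \<inter> J = {}" "indep (I \<union> J)"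
proof -
  have "\<exists>J. finite J \<and> card J = n \<and> I \<inter> J = {} \<and> indep (I \<union> J)"
  proof (induction n)
    case 0
    then show ?case using assms by (intro exI[of _ "{}"]) simp
  next
    case (Suc n)
    then obtain J where J: "finite J" "card J = n" "I \<inter> J = {}" "indep (I \<union> J)" by blast
    obtain u where "u \<notin> I \<union> J" "indep (insert u (I \<union> J))" using indep_extend1[OF J(4)] .
    then show ?case using J by (intro exI[of _ "insert u J"]) auto
  qed
  then show ?thesis using that by blast
qed

end

section \<open>Excluding the case \<open>m \<ge> 3\<close>\<close>

text \<open>Here \<open>k + 3\<close> stands for the least size \<open>m\<close> of a set without a
  common neighbour, so the hyperedges are the independent sets of size \<open>k + 2\<close>.\<close>

locale MB_graph_ext_bound = MB_graph_no_ext +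
  fixes k :: nat
  assumes common_neighbour: "\<And>S. finite S \<Longrightarrow> S \<subseteq> V \<Longrightarrow> card S = k + 2 \<Longrightarrow> \<exists>c\<in>V. adj_all c S"
    and no_common_neighbour: "\<And>S c. indep S \<Longrightarrow> card S = k + 3 \<Longrightarrow> \<not> adj_all c S"
begin

lemma indep_common_neighbour:
  assumes "indep U" "card U = k + 2"
  obtains c where "c \<in> V" "adj_all c U"
  using common_neighbour[of U] assms unfolding indep_def by blast

text \<open>Otherwise \<open>insert x T\<close> would be an independent set of size
  \<open>k + 3\<close> with common neighbour \<open>c\<close>. Hence a vertex attached to the
  hyperedge \<open>T\<close> meets \<open>I\<close> in exactly \<open>T\<close>.\<close>

lemma not_adj:
  assumes "indep I" "insert x T \<subseteq> I" "x \<notin> T" "card T = k + 2" "adj_all c T"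
  shows "\<not> E c x"
proof
  assume "E c x"
  then have "adj_all c (insert x T)" using assms unfolding adj_all_def by auto
  moreover have "indep (insert x T)" using indep_subset assms by blast
  moreover have "card (insert x T) = k + 3"
    using assms by (metis add_Suc_right card_insert_disjoint card_eq_0_iff
        add_is_0 numeral_2_eq_2 numeral_3_eq_3 nat.distinct(1))
  ultimately show False using no_common_neighbour by blast
qed

text \<open>Otherwise \<open>insert e U\<close> would be independent of size \<open>k + 3\<close>
  with common neighbour \<open>c\<close>. This is the counterpart of adjacent hyperedges having to
  intersect.\<close>

lemma adj_some:
  assumes "indep U" "card U = k + 2" "adj_all c U" "E e c" "e \<notin> U"
  shows "\<exists>u\<in>U. E e u"
proof (rule ccontr)
  assume "\<not> ?thesis"
  then have "indep (insert e U)"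
    using assms in_V by (intro indep_insert) auto
  moreover have "card (insert e U) = k + 3"
    using assms by (simp add: indep_def)
  moreover have "adj_all c (insert e U)" using assms sym unfolding adj_all_def by auto
  ultimately show False using no_common_neighbour by blast
qed

text \<open>These are \<open>k + 3\<close> vertices, one more than \<open>common_neighbour\<close>
  allows, but one edge among them suffices. It is enough to find one edge with \<open>k + 1\<close>
  further vertices, isolated in the configuration, that have a common neighbour, and to transfer
  this to \<open>p\<close>, \<open>q\<close>, \<open>R'\<close>.\<close>

lemma common_neighbour_edge:
  assumes pq: "E p q" and R': "finite R'" "R' \<subseteq> V" "card R' = k + 1" "p \<notin> R'" "q \<notin> R'"
  obtains e where "e \<in> V" "E e p" "E e q" "adj_all e R'"
proof -
  have "indep {}" unfolding indep_def by simp
  then obtain U where U: "finite U" "card U = k + 2" "indep U"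
    using indep_extend[of "{}" "k + 2"] by auto
  obtain Z where Z: "finite Z" "card Z = k + 1" "U \<inter> Z = {}" "indep (U \<union> Z)"
    using indep_extend[OF U(3), of "k + 1"] .
  have UZ: "U \<subseteq> V" "Z \<subseteq> V" "\<And>x y. x \<in> U \<union> Z \<Longrightarrow> y \<in> U \<union> Z \<Longrightarrow> \<not> E x y"
    using Z(4) unfolding indep_def by blast+
  obtain c where c: "c \<in> V" "adj_all c U" using indep_common_neighbour U by metis
  obtain z where z: "z \<in> Z" using Z(2) by fastforce
  have cZ: "\<not> E c x" if "x \<in> Z" for x
    using not_adj[OF Z(4), of x U c] that U c Z(3) by auto
  obtain u0 where u0: "u0 \<in> U" using U(2) by fastforce
  then have "E c u0" using c unfolding adj_all_def by blast
  then have cni: "c \<notin> U \<union> Z" using UZ u0 by blast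
  have "card (insert c Z) = k + 2" using Z cni by simp
  then obtain e where e: "e \<in> V" "adj_all e (insert c Z)"
    using common_neighbour[of "insert c Z"] Z UZ c by auto
  have "E e z" "E e c" using e z unfolding adj_all_def by auto
  then have "e \<notin> U" using UZ z by blast
  \<comment> \<open>\<open>e\<close> was chosen only for the \<open>k + 2\<close> vertices
    \<open>c\<close> and \<open>Z\<close>; the additional neighbour \<open>u\<close> comes for free
    and forms the edge \<open>u\<close>, \<open>c\<close>.\<close>
  then obtain u where u: "u \<in> U" "E e u" using adj_some[OF U(3,2) c(2) \<open>E e c\<close>] by blast
  have "p \<noteq> q" "u \<noteq> c" using pq irrefl u cni by auto
  let ?f = "\<lambda>x. if x = u then p else q"
  have f: "?f ` {u, c} = {p, q}" using \<open>u \<noteq> c\<close> by auto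
  have "\<exists>c'\<in>V. adj_all c' (?f ` {u, c} \<union> R')"
  proof (rule common_neighbour_transfer[where R = Z and c = e])
    show "{u, c} \<inter> Z = {}" using u Z(3) cni by auto
    show "\<not> E r x" if "r \<in> Z" "x \<in> {u, c} \<union> Z" for r x
      using that UZ(3) cZ sym u by blast
    show "inj_on ?f {u, c}" using \<open>p \<noteq> q\<close> by (auto simp: inj_on_def)
    show "adj_all e ({u, c} \<union> Z)" using e u unfolding adj_all_def by auto
    show "E (?f x) (?f y)" if "x \<in> {u, c}" "y \<in> {u, c}" "E x y" for x y
      using that irrefl pq sym by auto
  qed (use Z UZ u c R' in_V[OF pq] in auto)
  then show ?thesis using that unfolding f adj_all_def by auto
qed

text \<open>In the model, \<open>c\<close>, \<open>d\<close>, \<open>d'\<close> are attached to the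
  hyperedges \<open>{b, a} \<union> R\<close>, \<open>insert a Z\<close>, \<open>insert b Y\<close>.
  The last two are disjoint, so \<open>d\<close> and \<open>d'\<close> are not adjacent, and the
  neighbours \<open>a\<close>, \<open>d\<close>, \<open>b\<close>, \<open>d'\<close> of
  \<open>c\<close> span only the edges \<open>a d\<close> and \<open>b d'\<close>.\<close>

lemma common_neighbour_two_edges:
  assumes p: "E p1 p2" "E p3 p4" "distinct [p1, p2, p3, p4]"
    and R': "finite R'" "R' \<subseteq> V" "card R' = k" "{p1, p2, p3, p4} \<inter> R' = {}"
  obtains e where "e \<in> V" "adj_all e ({p1, p2, p3, p4} \<union> R')"
proof -
  have "indep {}" unfolding indep_def by simp
  then obtain a where a: "indep {a}" using indep_extend1 by metis
  obtain b where b: "b \<noteq> a" "indep {b, a}" using indep_extend1[OF a] by auto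
  obtain R where R: "finite R" "card R = k" "{b, a} \<inter> R = {}" "indep ({b, a} \<union> R)"
    using indep_extend[OF b(2)] .
  obtain Z where Z: "finite Z" "card Z = k + 1" "({b, a} \<union> R) \<inter> Z = {}" "indep ({b, a} \<union> R \<union> Z)"
    using indep_extend[OF R(4)] .
  obtain Y where Y: "finite Y" "card Y = k + 1" "({b, a} \<union> R \<union> Z) \<inter> Y = {}"
      "indep ({b, a} \<union> R \<union> Z \<union> Y)"
    using indep_extend[OF Z(4)] .
  let ?I = "{b, a} \<union> R \<union> Z \<union> Y"
  have IV: "?I \<subseteq> V" and nI: "\<And>x y. x \<in> ?I \<Longrightarrow> y \<in> ?I \<Longrightarrow> \<not> E x y"
    using Y(4) unfolding indep_def by blast+
  have "card ({b, a} \<union> R) = k + 2" using R b by simp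
  then obtain c where c: "c \<in> V" "adj_all c ({b, a} \<union> R)"
    using indep_common_neighbour[OF R(4)] by metis
  have ca: "E c a" and cb: "E c b" using c unfolding adj_all_def by auto
  have cI: "c \<notin> ?I" using ca nI by blast
  obtain d where d: "d \<in> V" "E d a" "E d c" "adj_all d Z"
    using common_neighbour_edge[of a c Z] sym[OF ca] Z IV cI by auto
  obtain d' where d': "d' \<in> V" "E d' b" "E d' c" "adj_all d' Y"
    using common_neighbour_edge[of b c Y] sym[OF cb] Y IV cI by auto
  have aZ: "card (insert a Z) = k + 2" "adj_all d (insert a Z)"
    using Z d unfolding adj_all_def by auto
  have bY: "card (insert b Y) = k + 2" "adj_all d' (insert b Y)"
    using Y d' unfolding adj_all_def by auto
  have nd: "\<not> E d x" if "x \<in> {b} \<union> R \<union> Y" for x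
    using not_adj[OF Y(4) _ _ aZ, of x] that b R(3) Z(3) Y(3) by auto
  have nd': "\<not> E d' x" if "x \<in> {a} \<union> R \<union> Z" for x
    using not_adj[OF Y(4) _ _ bY, of x] that b R(3) Z(3) Y(3) by auto
  have dI: "d \<notin> ?I" "d' \<notin> ?I" using d(2) d'(2) nI by blast+
  have ndd: "\<not> E d d'"
  proof
    assume "E d d'"
    moreover have "indep (insert a Z)" by (rule indep_subset[OF Y(4)]) auto
    ultimately obtain u where "u \<in> insert a Z" "E d' u"
      using adj_some[OF _ aZ, of d'] sym dI by blast
    then show False using nd' by blast
  qed
  have dist: "distinct [a, d, b, d']"
    using b(1) dI d(2) nd'[of a] by auto
  let ?f = "\<lambda>x. if x = a then p1 else if x = d then p2 else if x = b then p3 else p4"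
  have f: "?f ` {a, d, b, d'} = {p1, p2, p3, p4}" using dist by auto
  have "\<exists>c'\<in>V. adj_all c' (?f ` {a, d, b, d'} \<union> R')"
  proof (rule common_neighbour_transfer[where R = R and c = c])
    show "{a, d, b, d'} \<inter> R = {}" using R(3) dI by auto
    show "\<not> E r x" if "r \<in> R" "x \<in> {a, d, b, d'} \<union> R" for r x
      using that nI[of r x] nd[of r] nd'[of r] adj_commute[of r d] adj_commute[of r d'] by auto
    show "inj_on ?f {a, d, b, d'}" using p(3) dist by (auto simp: inj_on_def)
    show "adj_all c ({a, d, b, d'} \<union> R)" using c d(3) d'(3) sym unfolding adj_all_def by auto
    show "E (?f x) (?f y)" if "x \<in> {a, d, b, d'}" "y \<in> {a, d, b, d'}" "E x y" for x y
    proof -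
      have "\<not> E a b" "\<not> E d' a" "\<not> E d b" using nI[of a b] nd[of b] nd'[of a] by simp_all
      moreover from this have "\<not> E b a" "\<not> E a d'" "\<not> E b d" "\<not> E d' d"
        using ndd sym by metis+
      ultimately show ?thesis
        using that irrefl p(1,2) sym[OF p(1)] sym[OF p(2)] dist ndd by auto
    qed
    show "?f ` {a, d, b, d'} \<inter> R' = {}" unfolding f by (rule R')
    show "?f ` {a, d, b, d'} \<subseteq> V" unfolding f using in_V[OF p(1)] in_V[OF p(2)] by auto
  qed (use R IV d d' R' in auto)
  then show ?thesis using that unfolding f by blast
qed

text \<open>In the model, \<open>c\<close>, \<open>d\<close>, \<open>d'\<close> are attached to
  three hyperedges through the point \<open>a\<close>, with no other points in common. Any injection
  of \<open>a\<close>, \<open>d\<close>, \<open>d'\<close> into a triangle preserves edges, whether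
  or not \<open>d\<close> and \<open>d'\<close> are adjacent.\<close>

lemma common_neighbour_triangle:
  assumes p: "E p1 p2" "E p2 p3" "E p1 p3"
    and R': "finite R'" "R' \<subseteq> V" "card R' = k + 1" "{p1, p2, p3} \<inter> R' = {}"
  obtains e where "e \<in> V" "adj_all e ({p1, p2, p3} \<union> R')"
proof -
  have "indep {}" unfolding indep_def by simp
  then obtain a where a: "indep {a}" using indep_extend1 by metis
  obtain R where R: "finite R" "card R = k + 1" "{a} \<inter> R = {}" "indep ({a} \<union> R)"
    using indep_extend[OF a] .
  obtain Z where Z: "finite Z" "card Z = k + 1" "({a} \<union> R) \<inter> Z = {}" "indep ({a} \<union> R \<union> Z)"
    using indep_extend[OF R(4)] .
  obtain Y where Y: "finite Y" "card Y = k + 1" "({a} \<union> R \<union> Z) \<inter> Y = {}"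
      "indep ({a} \<union> R \<union> Z \<union> Y)"
    using indep_extend[OF Z(4)] .
  let ?I = "{a} \<union> R \<union> Z \<union> Y"
  have IV: "?I \<subseteq> V" and nI: "\<And>x y. x \<in> ?I \<Longrightarrow> y \<in> ?I \<Longrightarrow> \<not> E x y"
    using Y(4) unfolding indep_def by blast+
  have "card ({a} \<union> R) = k + 2" using R by simp
  then obtain c where c: "c \<in> V" "adj_all c ({a} \<union> R)"
    using indep_common_neighbour[OF R(4)] by metis
  have ca: "E c a" using c unfolding adj_all_def by auto
  have cI: "c \<notin> ?I" using ca nI by blast
  obtain d where d: "d \<in> V" "E d a" "E d c" "adj_all d Z"
    using common_neighbour_edge[of a c Z] sym[OF ca] Z IV cI by auto
  obtain d' where d': "d' \<in> V" "E d' a" "E d' c" "adj_all d' Y"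
    using common_neighbour_edge[of a c Y] sym[OF ca] Y IV cI by auto
  have aZ: "card (insert a Z) = k + 2" "adj_all d (insert a Z)"
    using Z d unfolding adj_all_def by auto
  have aY: "card (insert a Y) = k + 2" "adj_all d' (insert a Y)"
    using Y d' unfolding adj_all_def by auto
  have nd: "\<not> E d x" if "x \<in> R \<union> Y" for x
    using not_adj[OF Y(4) _ _ aZ, of x] that R(3) Z(3) Y(3) by auto
  have nd': "\<not> E d' x" if "x \<in> R \<union> Z" for x
    using not_adj[OF Y(4) _ _ aY, of x] that R(3) Z(3) Y(3) by auto
  have dI: "d \<notin> ?I" "d' \<notin> ?I" using d(2) d'(2) nI by blast+
  obtain z where "z \<in> Z" using Z(2) by fastforce
  then have "d \<noteq> d'" using d(4) nd'[of z] unfolding adj_all_def by auto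
  then have dist: "distinct [a, d, d']" using dI by auto
  have p': "distinct [p1, p2, p3]" using p irrefl by auto
  let ?f = "\<lambda>x. if x = a then p1 else if x = d then p2 else p3"
  have f: "?f ` {a, d, d'} = {p1, p2, p3}" using dist by auto
  have "\<exists>c'\<in>V. adj_all c' (?f ` {a, d, d'} \<union> R')"
  proof (rule common_neighbour_transfer[where R = R and c = c])
    show "{a, d, d'} \<inter> R = {}" using R(3) dI by auto
    show "\<not> E r x" if "r \<in> R" "x \<in> {a, d, d'} \<union> R" for r x
      using that nI[of r x] nd[of r] nd'[of r] adj_commute[of r d] adj_commute[of r d'] by auto
    show "inj_on ?f {a, d, d'}" using p' dist by (auto simp: inj_on_def)
    show "adj_all c ({a, d, d'} \<union> R)" using c d(3) d'(3) sym unfolding adj_all_def by auto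
    show "E (?f x) (?f y)" if "x \<in> {a, d, d'}" "y \<in> {a, d, d'}" "E x y" for x y
      using that irrefl p p[THEN sym] dist by auto
    show "?f ` {a, d, d'} \<inter> R' = {}" unfolding f by (rule R')
    show "?f ` {a, d, d'} \<subseteq> V" unfolding f using in_V[OF p(1)] in_V[OF p(2)] by auto
  qed (use R IV d d' R' in auto)
  then show ?thesis using that unfolding f by blast
qed

text \<open>The pairwise adjacent vertices \<open>c1\<close>, \<open>c2\<close>, \<open>c3\<close> play the role of hyperedges with empty
  intersection; a common neighbour of them and of \<open>Z\<close> has at most one neighbour in the independent set outside \<open>Z\<close>,
  but it needs one in each of the three hyperedges.\<close>

lemma contradiction: False
proof -
  have "indep {}" unfolding indep_def by simp
  then obtain a where a: "indep {a}" using indep_extend1 by metis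
  obtain X where X: "finite X" "card X = k + 1" "{a} \<inter> X = {}" "indep ({a} \<union> X)"
    using indep_extend[OF a] .
  obtain Y where Y: "finite Y" "card Y = k + 1" "({a} \<union> X) \<inter> Y = {}" "indep ({a} \<union> X \<union> Y)"
    using indep_extend[OF X(4)] .
  obtain R where R: "finite R" "card R = k" "({a} \<union> X \<union> Y) \<inter> R = {}" "indep ({a} \<union> X \<union> Y \<union> R)"
    using indep_extend[OF Y(4)] .
  obtain Z where Z: "finite Z" "card Z = k + 1" "({a} \<union> X \<union> Y \<union> R) \<inter> Z = {}"
      "indep ({a} \<union> X \<union> Y \<union> R \<union> Z)"
    using indep_extend[OF R(4)] .
  let ?I = "{a} \<union> X \<union> Y \<union> R \<union> Z"
  have IV: "?I \<subseteq> V" and nI: "\<And>x y. x \<in> ?I \<Longrightarrow> y \<in> ?I \<Longrightarrow> \<not> E x y"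
    using Z(4) unfolding indep_def by blast+
  obtain x y z where x: "x \<in> X" and y: "y \<in> Y" and z: "z \<in> Z"
    using X(2) Y(2) Z(2) by fastforce
  have U1: "indep (insert a X)" "card (insert a X) = k + 2"
    using X indep_subset[OF Z(4)] by auto
  have U2: "indep (insert a Y)" "card (insert a Y) = k + 2"
    using Y indep_subset[OF Z(4), of "insert a Y"] by auto
  have "x \<noteq> y" "x \<notin> R" "y \<notin> R" using x y Y(3) R(3) by auto
  then have "card (insert x (insert y R)) = k + 2" using R by simp
  moreover have "indep (insert x (insert y R))" by (rule indep_subset[OF Z(4)]) (use x y in auto)
  ultimately have U3: "indep (insert x (insert y R))" "card (insert x (insert y R)) = k + 2" by auto
  obtain c1 where c1: "c1 \<in> V" "adj_all c1 (insert a X)" using indep_common_neighbour U1 by metis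
  have c1a: "E c1 a" and c1x: "E c1 x" using c1 x unfolding adj_all_def by auto
  have c1I: "c1 \<notin> ?I" using c1a nI by blast
  obtain c2 where c2: "c2 \<in> V" "E c2 a" "E c2 c1" "adj_all c2 Y"
    using common_neighbour_edge[of a c1 Y] sym[OF c1a] Y IV c1I by auto
  have c2': "adj_all c2 (insert a Y)" "E c2 y" using c2 y unfolding adj_all_def by auto
  have c2I: "c2 \<notin> ?I" using c2(2) nI by blast
  have "distinct [x, c1, y, c2]" using \<open>x \<noteq> y\<close> c1I c2I x y c2(3) irrefl by auto
  moreover have "{x, c1, y, c2} \<inter> R = {}" using \<open>x \<notin> R\<close> \<open>y \<notin> R\<close> c1I c2I by auto
  \<comment> \<open>The hyperedges \<open>insert a X\<close>, \<open>insert a Y\<close> and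
    \<open>insert x (insert y R)\<close> meet pairwise in \<open>a\<close>, \<open>x\<close>,
    \<open>y\<close>. The edges \<open>x c1\<close> and \<open>y c2\<close> are disjoint, so a
    single vertex \<open>c3\<close> can be attached to the third hyperedge and adjacent to both
    \<open>c1\<close> and \<open>c2\<close>.\<close>
  ultimately obtain c3 where c3: "c3 \<in> V" "adj_all c3 ({x, c1, y, c2} \<union> R)"
    using common_neighbour_two_edges[of x c1 y c2 R] sym[OF c1x] sym[OF c2'(2)] R IV by auto
  have c3': "adj_all c3 (insert x (insert y R))" "E c3 c1" "E c3 c2" "E c3 x"
    using c3 unfolding adj_all_def by auto
  have c3I: "c3 \<notin> ?I" using c3'(4) nI x by blast
  obtain e where e: "e \<in> V" "adj_all e ({c1, c2, c3} \<union> Z)"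
    using common_neighbour_triangle[of c1 c2 c3 Z] sym c2(3) c3' Z IV c1I c2I c3I by auto
  have e': "E e c1" "E e c2" "E e c3" "E e z" using e z unfolding adj_all_def by auto
  have eI: "e \<notin> ?I" using e'(4) nI z by blast
  have unique: "u = v" if u: "u \<in> {a} \<union> X \<union> Y \<union> R" "v \<in> {a} \<union> X \<union> Y \<union> R" "E e u" "E e v" for u v
  proof (rule ccontr)
    assume "u \<noteq> v"
    have "u \<notin> Z" "v \<notin> Z" using u(1,2) Z(3) by blast+
    then have "card (insert u Z) = k + 2" "adj_all e (insert u Z)"
      using Z(1,2) u e unfolding adj_all_def by auto
    then have "\<not> E e v"
      using not_adj[OF Z(4), of v "insert u Z" e] u(1,2) \<open>v \<notin> Z\<close> \<open>u \<noteq> v\<close> by auto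
    then show False using u by blast
  qed
  obtain u1 where u1: "u1 \<in> insert a X" "E e u1" using adj_some[OF U1 c1(2) e'(1)] eI by auto
  obtain u2 where u2: "u2 \<in> insert a Y" "E e u2" using adj_some[OF U2 c2'(1) e'(2)] eI by auto
  obtain u3 where u3: "u3 \<in> insert x (insert y R)" "E e u3"
    using adj_some[OF U3 c3'(1) e'(3)] eI x y by auto
  have "u1 = u2" by (rule unique) (use u1 u2 in auto)
  moreover have "u1 = u3" by (rule unique) (use u1 u3 x y in auto)
  ultimately show False using u1 u2 u3 X(3) Y(3) R(3) x y by auto
qed

end

section \<open>Components are infinite cliques\<close>

context MB_graph_no_ext
begin

text \<open>If \<open>x\<close> and \<open>y\<close> were not adjacent, \<open>{x}\<close> and
  \<open>{x, y}\<close> would be independent sets with common neighbour \<open>z\<close>; this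
  forces \<open>m \<ge> 3\<close>, the case just excluded.\<close>

lemma adj_trans:
  assumes "E x z" "E z y" "x \<noteq> y"
  shows "E x y"
proof (rule ccontr)
  assume nxy: "\<not> E x y"
  let ?P = "\<lambda>n. \<exists>S. finite S \<and> S \<subseteq> V \<and> card S = n \<and> (\<forall>c\<in>V. \<not> adj_all c S)"
  define m where "m = (LEAST n. ?P n)"
  have "\<exists>n. ?P n" using no_ext by blast
  then have "?P m" unfolding m_def by (rule LeastI_ex)
  then obtain F where F: "finite F" "F \<subseteq> V" "card F = m" "\<And>c. c \<in> V \<Longrightarrow> \<not> adj_all c F" by blast
  have least: "\<exists>c\<in>V. adj_all c S" if "finite S" "S \<subseteq> V" "card S < m" for S
    using not_less_Least[of "card S" ?P] that unfolding m_def by blast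
  \<comment> \<open>An independent \<open>m\<close>-set maps onto \<open>F\<close> by a
    monomorphism, so a common neighbour of it would yield one of \<open>F\<close>.\<close>
  have fail: "\<not> adj_all c S" if S: "indep S" "card S = m" for S c
  proof
    assume "adj_all c S"
    then have "\<exists>c'\<in>V. adj_all c' (id ` {} \<union> F)"
      using S F by (intro common_neighbour_transfer[where R = S and c = c]) (auto simp: indep_def)
    then show False using F by simp
  qed
  have xyV: "x \<in> V" "y \<in> V" "z \<in> V" using assms in_V by blast+
  have xy: "indep {x, y}" using nxy sym irrefl xyV unfolding indep_def by auto
  have z: "adj_all z {x, y}" using assms sym unfolding adj_all_def by auto
  have "F \<noteq> {}" using F(4) xyV unfolding adj_all_def by blast
  then have "m \<noteq> 0" using F by auto
  moreover have "m \<noteq> 1"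
    using fail[of "{x}" z] xy z indep_subset[OF xy, of "{x}"] unfolding adj_all_def by auto
  moreover have "m \<noteq> 2" using fail[OF xy, of z] z assms(3) by auto
  ultimately have "m = (m - 3) + 3" by arith
  then obtain k where k: "m = k + 3" by blast
  interpret MB_graph_ext_bound V E k
    by unfold_locales (use least fail k in auto)
  show False by (rule contradiction)
qed

text \<open>If \<open>a\<close> had a finite closed neighbourhood \<open>?C\<close>, take
  \<open>b\<close> outside it and a neighbour \<open>a'\<close> of \<open>a\<close>. A bimorphism
  fixing \<open>a\<close> and sending \<open>b\<close> to \<open>a'\<close> permutes the finite set
  \<open>?C\<close>, so it takes the value \<open>a'\<close> both at \<open>b\<close> and inside
  \<open>?C\<close>, against injectivity.\<close>

lemma infinite_component:
  assumes "E u u'" "a \<in> V"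
  shows "infinite {x. E a x}"
proof
  assume fin: "finite {x. E a x}"
  let ?C = "insert a {x. E a x}"
  have "?C \<subseteq> V" using assms(2) in_V by blast
  obtain b where b: "b \<in> V" "b \<notin> ?C" using fresh_vertex[of ?C] fin by auto
  \<comment> \<open>The edge \<open>u u'\<close> is transported so that \<open>u'\<close> goes to
    \<open>a\<close>; hence \<open>a\<close> has a neighbour.\<close>
  obtain a' where a': "E a' a"
    using common_neighbour_transfer[of "{u'}" "{}" "\<lambda>_. a" "{}" u] assms in_V irrefl
    unfolding adj_all_def by auto
  let ?f = "\<lambda>x. if x = a then a else a'"
  obtain g where g: "bij_betw g V V" "\<And>x y. E x y \<Longrightarrow> E (g x) (g y)" "\<And>x. x \<in> {a, b} \<Longrightarrow> g x = ?f x"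
  proof (rule bimorphism_extends[of "{a, b}" ?f])
    show "inj_on ?f {a, b}" using a' irrefl by (auto simp: inj_on_def)
    show "E (?f x) (?f y)" if "x \<in> {a, b}" "y \<in> {a, b}" "E x y" for x y
      using that a' irrefl sym by auto
  qed (use assms b a' in_V in auto)
  have gab: "g a = a" "g b = a'" using g(3) b by auto
  have sub: "g ` ?C \<subseteq> ?C" using g(2)[of a] gab by auto
  moreover have inj: "inj_on g V" using g(1) unfolding bij_betw_def by blast
  ultimately have "g ` ?C = ?C"
    using fin inj_on_subset[OF inj \<open>?C \<subseteq> V\<close>] by (intro endo_inj_surj) simp_all
  then obtain t where "t \<in> ?C" "g t = a'" using a' sym by (metis imageE insertI2 mem_Collect_eq)
  then have "t = b" using inj gab b \<open>?C \<subseteq> V\<close> by (metis inj_onD subsetD)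
  then show False using \<open>t \<in> ?C\<close> b by blast
qed

end

section \<open>Putting a prescribed vertex into the range\<close>

theorem theorem6p1:
  fixes V :: "'a set" and E :: "'a \<Rightarrow> 'a \<Rightarrow> bool"
  assumes "graph V E" and "countable V" and "infinite V"
    and "MB_homogeneous V E"
  shows "HE_homogeneous V E"
proof -
  interpret G: MB_graph V E by unfold_locales (use assms in auto)
  let ?H = "\<lambda>x y. x \<in> V \<and> y \<in> V \<and> x \<noteq> y \<and> \<not> E x y"
  interpret H: MB_graph V ?H
    by unfold_locales (use assms graph_complement MB_homogeneous_complement in blast)+
  show ?thesis
  proof (rule HE_homogeneous_back_and_forth[OF assms(2,3) G.hom_on_extend])
    fix A f w assume A: "finite A" "hom_on V E A f" and w: "w \<in> V" "w \<notin> f ` A"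
    have AV: "A \<subseteq> V" "f ` A \<subseteq> V" "\<And>x y. x \<in> A \<Longrightarrow> y \<in> A \<Longrightarrow> E x y \<Longrightarrow> E (f x) (f y)"
      using A(2) unfolding hom_on_def by blast+
    have "\<exists>v\<in>V. v \<notin> A \<and> (\<forall>a\<in>A. E v a \<longrightarrow> E w (f a))"
    proof (cases "\<exists>v. v \<in> V \<and> v \<notin> A \<and> (\<forall>a\<in>A. \<not> E v a)")
      case True
      then show ?thesis by blast
    next
      case False
      \<comment> \<open>Every vertex outside \<open>A\<close> now has an \<open>E\<close>-neighbour
        in \<open>A\<close>, so \<open>A\<close> itself is a finite set without a common neighbour
        in the complement.\<close>
      have "\<not> H.adj_all c A" for c
      proof (cases "A = {}")
        case True
        then show ?thesis using False assms(3) by (metis empty_iff finite.emptyI subsetI subset_antisym)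
      next
        case ne: False
        then show ?thesis using False AV(1) unfolding H.adj_all_def by blast
      qed
      then interpret H: MB_graph_no_ext V ?H
        by unfold_locales (use A(1) AV(1) in blast)
      show ?thesis
      proof (cases "\<forall>a\<in>A. E w (f a)")
        case True
        obtain v where "v \<in> V" "v \<notin> A" using A(1) by (rule G.fresh_vertex)
        then show ?thesis using True by blast
      next
        case nadj: False
        then obtain a where a: "a \<in> A" "\<not> E w (f a)" by blast
        then have "?H w (f a)" using w AV by auto
        then have "infinite {x. ?H a x}" using H.infinite_component[of w "f a" a] a AV(1) by auto
        then have "\<not> {x. ?H a x} \<subseteq> A" using A(1) finite_subset by metis
        \<comment> \<open>In \<open>E\<close>, non-adjacency is an equivalence relation.
          \<open>v\<close> is taken from the class of \<open>a\<close>, as \<open>w\<close> lies in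
          the class of \<open>f a\<close>: if \<open>v\<close> is adjacent to \<open>b\<close>, then
          so is \<open>a\<close>, hence \<open>f a\<close> is adjacent to \<open>f b\<close>, and so
          is \<open>w\<close>.\<close>
        then obtain v where v: "?H a v" "v \<notin> A" by blast
        have "E w (f b)" if b: "b \<in> A" "E v b" for b
        proof (rule ccontr)
          assume nb: "\<not> E w (f b)"
          have "b \<noteq> a" using v(1) b G.sym by blast
          have "E a b"
          proof (rule ccontr)
            assume "\<not> E a b"
            then have "?H v a" "?H a b" using v(1) b a AV(1) \<open>b \<noteq> a\<close> G.sym by blast+
            then have "?H v b" using H.adj_trans[of v a b] b v(2) by blast
            then show False using b by blast
          qed
          then have ab: "E (f a) (f b)" using AV(3) a b by blast
          have "?H (f a) w" "?H w (f b)" using a nb b w AV G.sym by blast+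
          then have "?H (f a) (f b)" using H.adj_trans[of "f a" w "f b"] ab G.irrefl by metis
          then show False using ab by blast
        qed
        then show ?thesis using v by blast
      qed
    qed
    then obtain v where v: "v \<in> V" "v \<notin> A" "\<And>a. a \<in> A \<Longrightarrow> E v a \<Longrightarrow> E w (f a)" by blast
    then have "hom_on V E (insert v A) (f(v := w))"
      using AV w G.irrefl G.adj_commute[of _ v] G.adj_commute[of _ w] unfolding hom_on_def by auto
    then show "\<exists>v\<in>V. v \<notin> A \<and> hom_on V E (insert v A) (f(v := w))" using v by blast
  qed
qed

end
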